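(* Let $a,b\in\mathbb{C}$. Any commutative post-Lie algebra structure $\circ$ on the Lie algebra $\mathcal{W}(a,b)$ is trivial, i.e. $x\circ y=0$ for all $x,y\in\mathcal{W}(a,b)$.
   Context: All vector spaces and algebras are over $\mathbb{C}$. For $a,b\in\mathbb{C}$, $\mathcal{W}(a,b)$ is the complex Lie algebra with basis $\{L_m,I_m\mid m\in\mathbb{Z}\}$ and brackets $$[L_m,L_n]=(m-n)L_{m+n},\quad [L_m,I_n]=-(n+a+bm)I_{m+n},\quad [I_m,I_n]=0\qquad(m,n\in\mathbb{Z}).$$ A commutative post-Lie algebra structure on a complex Lie algebra $(L,[\,,])$ is a $\mathbb{C}$-bilinear product $x\circ y$ on $L$ satisfying, for all $x,y,z\in L$: $$x\circ y=y\circ x,\qquad [x,y]\circ z=x\circ(y\circ z)-y\circ(x\circ z),\qquad x\circ[y,z]=[x\circ y,z]+[y,x\circ z].$$ It is called trivial if $x\circ y=0$ for all $x,y\in L$. *)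

theory Defs
  imports Complex_Main "HOL-Library.Poly_Mapping"
begin

locale lie_algebra = vector_space scale
  for scale :: "complex \<Rightarrow> 'v::ab_group_add \<Rightarrow> 'v" +
  fixes bracket :: "'v \<Rightarrow> 'v \<Rightarrow> 'v"
  assumes bracket_linear_right: "Vector_Spaces.linear scale scale (\<lambda>y. bracket x y)"
    and bracket_linear_left: "Vector_Spaces.linear scale scale (\<lambda>x. bracket x y)"
    and bracket_alternating: "bracket x x = 0"
    and jacobi: "bracket x (bracket y z) + bracket y (bracket z x) + bracket z (bracket x y) = 0"

locale commutative_post_lie = lie_algebra scale bracket
  for scale :: "complex \<Rightarrow> 'v::ab_group_add \<Rightarrow> 'v" and bracket :: "'v \<Rightarrow> 'v \<Rightarrow> 'v" +
  fixes pr :: "'v \<Rightarrow> 'v \<Rightarrow> 'v"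
  assumes product_linear_right: "Vector_Spaces.linear scale scale (\<lambda>y. pr x y)"
    and product_linear_left: "Vector_Spaces.linear scale scale (\<lambda>x. pr x y)"
    and product_commute: "pr x y = pr y x"
    and bracket_product: "pr (bracket x y) z = pr x (pr y z) - pr y (pr x z)"
    and product_bracket: "pr x (bracket y z) = bracket (pr x y) z + bracket y (pr x z)"

datatype w_basis = L int | I int

text \<open>The underlying space of every \<open>W(a,b)\<close> is the free complex vector space on the basis
  \<open>L m, I m\<close>; the basis vector belonging to \<open>i\<close> is \<open>Poly_Mapping.single i 1\<close>.\<close>

type_synonym w_space = "w_basis \<Rightarrow>\<^sub>0 complex"

definition w_scale :: "complex \<Rightarrow> w_space \<Rightarrow> w_space" where
  "w_scale c x = Poly_Mapping.map (\<lambda>t. c * t) x"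

text \<open>The third equation is the second one read through antisymmetry.\<close>

fun w_basis_bracket :: "complex \<Rightarrow> complex \<Rightarrow> w_basis \<Rightarrow> w_basis \<Rightarrow> w_space" where
  "w_basis_bracket a b (L m) (L n) = Poly_Mapping.single (L (m + n)) (of_int (m - n))"
| "w_basis_bracket a b (L m) (I n) = Poly_Mapping.single (I (m + n)) (- (of_int n + a + b * of_int m))"
| "w_basis_bracket a b (I m) (L n) = Poly_Mapping.single (I (n + m)) (of_int m + a + b * of_int n)"
| "w_basis_bracket a b (I m) (I n) = 0"

definition w_bracket :: "complex \<Rightarrow> complex \<Rightarrow> w_space \<Rightarrow> w_space \<Rightarrow> w_space" where
  "w_bracket a b x y =
    (\<Sum>i\<in>Poly_Mapping.keys x. \<Sum>j\<in>Poly_Mapping.keys y.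
      w_scale (Poly_Mapping.lookup x i * Poly_Mapping.lookup y j) (w_basis_bracket a b i j))"

lemma lookup_w_scale [simp]: "Poly_Mapping.lookup (w_scale c x) k = c * Poly_Mapping.lookup x k"
  by (auto simp: w_scale_def Poly_Mapping.map.rep_eq when_def)

lemma w_scale_single [simp]: "w_scale c (Poly_Mapping.single k t) = Poly_Mapping.single k (c * t)"
  by (rule poly_mapping_eqI) (simp add: lookup_single when_def)

lemma vector_space_w_scale: "vector_space w_scale"
  by unfold_locales (auto intro!: poly_mapping_eqI simp: lookup_add algebra_simps)

interpretation w: vector_space w_scale
  by (rule vector_space_w_scale)

lemma w_bracket_superset:
  assumes "finite A" "finite B" "Poly_Mapping.keys x \<subseteq> A" "Poly_Mapping.keys y \<subseteq> B"
  shows "w_bracket a b x y = (\<Sum>i\<in>A. \<Sum>j\<in>B.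
    w_scale (Poly_Mapping.lookup x i * Poly_Mapping.lookup y j) (w_basis_bracket a b i j))"
proof -
  have "w_bracket a b x y = (\<Sum>i\<in>Poly_Mapping.keys x. \<Sum>j\<in>B.
    w_scale (Poly_Mapping.lookup x i * Poly_Mapping.lookup y j) (w_basis_bracket a b i j))"
    unfolding w_bracket_def
    by (intro sum.cong refl sum.mono_neutral_left assms) (auto simp: in_keys_iff)
  also have "\<dots> = (\<Sum>i\<in>A. \<Sum>j\<in>B.
    w_scale (Poly_Mapping.lookup x i * Poly_Mapping.lookup y j) (w_basis_bracket a b i j))"
    by (intro sum.mono_neutral_left assms) (auto simp: in_keys_iff)
  finally show ?thesis .
qed

lemma w_bracket_single [simp]:
  "w_bracket a b (Poly_Mapping.single i s) (Poly_Mapping.single j t) =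
    w_scale (s * t) (w_basis_bracket a b i j)"
  by (subst w_bracket_superset[of "{i}" "{j}"]) auto

lemma w_bracket_add_left: "w_bracket a b (x + x') y = w_bracket a b x y + w_bracket a b x' y"
proof -
  let ?A = "Poly_Mapping.keys x \<union> Poly_Mapping.keys x'" and ?B = "Poly_Mapping.keys y"
  have "Poly_Mapping.keys (x + x') \<subseteq> ?A" by (rule Poly_Mapping.keys_add)
  then show ?thesis
    by (simp add: w_bracket_superset[of ?A ?B] lookup_add distrib_right w.scale_left_distrib
        sum.distrib)
qed

lemma w_bracket_antisym: "w_bracket a b y x = - w_bracket a b x y"
proof -
  have *: "w_basis_bracket a b j i = - w_basis_bracket a b i j" for i j
    by (cases i; cases j) (auto intro!: poly_mapping_eqI simp: lookup_single when_def add.commute)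
  have "w_bracket a b y x = (\<Sum>i\<in>Poly_Mapping.keys x. \<Sum>j\<in>Poly_Mapping.keys y.
      w_scale (Poly_Mapping.lookup y j * Poly_Mapping.lookup x i) (w_basis_bracket a b j i))"
    unfolding w_bracket_def by (rule sum.swap)
  also have "\<dots> = (\<Sum>i\<in>Poly_Mapping.keys x. \<Sum>j\<in>Poly_Mapping.keys y.
      - w_scale (Poly_Mapping.lookup x i * Poly_Mapping.lookup y j) (w_basis_bracket a b i j))"
    by (intro sum.cong refl) (metis * mult.commute w.scale_minus_right)
  also have "\<dots> = - w_bracket a b x y"
    by (simp add: w_bracket_def sum_negf)
  finally show ?thesis .
qed

lemma w_bracket_scale_left: "w_bracket a b (w_scale c x) y = w_scale c (w_bracket a b x y)"
proof -
  let ?A = "Poly_Mapping.keys x" and ?B = "Poly_Mapping.keys y"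
  have "Poly_Mapping.keys (w_scale c x) \<subseteq> ?A" by (auto simp: in_keys_iff)
  then show ?thesis
    by (simp add: w_bracket_superset[of ?A ?B] w.scale_sum_right mult.assoc)
qed

lemma w_bracket_add_right: "w_bracket a b x (y + y') = w_bracket a b x y + w_bracket a b x y'"
  by (metis w_bracket_antisym w_bracket_add_left minus_add_distrib)

lemma w_bracket_scale_right: "w_bracket a b x (w_scale c y) = w_scale c (w_bracket a b x y)"
  by (metis w_bracket_antisym w_bracket_scale_left w.scale_minus_right)

lemma w_bracket_zero [simp]: "w_bracket a b 0 y = 0" "w_bracket a b x 0 = 0"
  by (simp_all add: w_bracket_def)

lemma w_space_induct [case_names zero add]:
  assumes "P 0" and "\<And>i t x. P x \<Longrightarrow> P (Poly_Mapping.single i t + x)"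
  shows "P (x :: w_space)"
proof -
  have "P x" if "finite A" "Poly_Mapping.keys x \<subseteq> A" for A x
    using that
  proof (induction A arbitrary: x rule: finite_induct)
    case empty
    then have "x = 0" by simp
    then show ?case using assms(1) by simp
  next
    case (insert i A)
    let ?s = "Poly_Mapping.single i (Poly_Mapping.lookup x i)"
    have "Poly_Mapping.keys (x - ?s) \<subseteq> A"
      using insert.prems by (auto simp: in_keys_iff lookup_minus lookup_single when_def split: if_splits)
    then have "P (?s + (x - ?s))" by (intro assms(2) insert.IH)
    then show ?case by simp
  qed
  then show ?thesis using finite_keys by blast
qed

theorem lie_algebra_w: "lie_algebra w_scale (w_bracket a b)"
proof -
  let ?J = "\<lambda>x y z. w_bracket a b x (w_bracket a b y z) + w_bracket a b y (w_bracket a b z x)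
    + w_bracket a b z (w_bracket a b x y)"
  have basis: "?J (Poly_Mapping.single i r) (Poly_Mapping.single j s) (Poly_Mapping.single k t) = 0"
    for i j k r s t
    by (cases i; cases j; cases k)
      (auto intro!: poly_mapping_eqI simp: lookup_add lookup_single when_def algebra_simps)
  have add_J: "?J (x + x') y z = ?J x y z + ?J x' y z" for x x' y z
    by (simp add: w_bracket_add_left w_bracket_add_right algebra_simps)
  have J3: "?J (Poly_Mapping.single i r) (Poly_Mapping.single j s) z = 0" for i r j s z
  proof (induction z rule: w_space_induct)
    case (add k t z)
    then show ?case using basis[of i r j s k t]
      by (simp add: w_bracket_add_left w_bracket_add_right algebra_simps del: w_bracket_single)
  qed simp
  have J2: "?J (Poly_Mapping.single i r) y z = 0" for i r y z
  proof (induction y rule: w_space_induct)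
    case (add k t y)
    then show ?case using J3[of i r k t z]
      by (simp add: w_bracket_add_left w_bracket_add_right algebra_simps del: w_bracket_single)
  qed simp
  have J: "?J x y z = 0" for x y z
  proof (induction x rule: w_space_induct)
    case (add k t x)
    then show ?case using J2[of k t y z] by (simp only: add_J add_0_left)
  qed simp
  have alt: "w_bracket a b x x = 0" for x
  proof (rule poly_mapping_eqI)
    fix k
    have "Poly_Mapping.lookup (w_bracket a b x x) k = - Poly_Mapping.lookup (w_bracket a b x x) k"
      by (metis w_bracket_antisym lookup_uminus uminus_apply)
    then show "Poly_Mapping.lookup (w_bracket a b x x) k = Poly_Mapping.lookup 0 k" by simp
  qed
  show ?thesis
    by unfold_locales
      (use J alt in \<open>auto simp: w_bracket_add_left w_bracket_add_right
        w_bracket_scale_left w_bracket_scale_right\<close>)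
qed

end

theory Submission
  imports Defs
begin

text \<open>Write \<open>D x = pr x\<close>. Expanding \<open>D x [L 0, y]\<close> expresses every component of \<open>pr x y\<close> whose
  \<open>L 0\<close>-weight differs from that of \<open>y\<close> through \<open>[pr x (L 0), y]\<close>, and by commutativity the same holds
  with \<open>x\<close> and \<open>y\<close> exchanged. Comparing the two shows that all products lie in the abelian ideal
  spanned by the \<open>I n\<close>. Hence \<open>D x\<close> commutes on that ideal with every \<open>ad (L m)\<close>, which together
  with commutativity forces \<open>pr x (I n) = 0\<close>. Finally
  \<open>pr [L p, L q] z = D (L p) (D (L q) z) - D (L q) (D (L p) z) = 0\<close>, and the \<open>L n\<close> span a
  perfect algebra.\<close>

section \<open>Coordinates of brackets with a basis vector\<close>

abbreviation w_L :: "int \<Rightarrow> w_space" where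
  "w_L m \<equiv> Poly_Mapping.single (L m) 1"

abbreviation w_I :: "int \<Rightarrow> w_space" where
  "w_I m \<equiv> Poly_Mapping.single (I m) 1"

abbreviation L_coeff :: "w_space \<Rightarrow> int \<Rightarrow> complex" where
  "L_coeff x k \<equiv> Poly_Mapping.lookup x (L k)"

abbreviation I_coeff :: "w_space \<Rightarrow> int \<Rightarrow> complex" where
  "I_coeff x k \<equiv> Poly_Mapping.lookup x (I k)"

lemma w_space_eqI:
  assumes "\<And>k. L_coeff x k = L_coeff y k" "\<And>k. I_coeff x k = I_coeff y k"
  shows "x = y"
proof (rule poly_mapping_eqI)
  show "Poly_Mapping.lookup x i = Poly_Mapping.lookup y i" for i
    using assms by (cases i) auto
qed

lemma L_coeff_bracket_L:
  "L_coeff (w_bracket a b x (w_L n)) k = of_int (k - 2 * n) * L_coeff x (k - n)"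
proof (induction x rule: w_space_induct)
  case (add i t x)
  then show ?case
    by (cases i) (auto simp: w_bracket_add_left lookup_add lookup_single when_def algebra_simps)
qed simp

lemma I_coeff_bracket_L:
  "I_coeff (w_bracket a b x (w_L n)) k
    = (of_int (k - n) + a + b * of_int n) * I_coeff x (k - n)"
proof (induction x rule: w_space_induct)
  case (add i t x)
  then show ?case
    by (cases i) (auto simp: w_bracket_add_left lookup_add lookup_single when_def algebra_simps)
qed simp

lemma L_coeff_bracket_I: "L_coeff (w_bracket a b x (w_I n)) k = 0"
proof (induction x rule: w_space_induct)
  case (add i t x)
  then show ?case
    by (cases i) (auto simp: w_bracket_add_left lookup_add lookup_single when_def)
qed simp

lemma I_coeff_bracket_I:
  "I_coeff (w_bracket a b x (w_I n)) k
    = - (of_int n + a + b * of_int (k - n)) * L_coeff x (k - n)"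
proof (induction x rule: w_space_induct)
  case (add i t x)
  then show ?case
    by (cases i) (auto simp: w_bracket_add_left lookup_add lookup_single when_def algebra_simps)
qed simp

lemmas coeff_bracket = L_coeff_bracket_L I_coeff_bracket_L L_coeff_bracket_I I_coeff_bracket_I

text \<open>Here \<open>[L p, L q]\<close> is a nonzero multiple of \<open>L m\<close>, so a
  vanishing statement known at all indices other than \<open>m\<close> passes to \<open>m\<close>.
  The last two conditions also make \<open>p\<close> and \<open>q\<close> nonzero.\<close>

lemma int_split_distinct:
  fixes m :: int
  obtains p q where "p + q = m" "p \<noteq> q" "p \<noteq> m" "q \<noteq> m"
\<comment> \<open>The pair \<open>m + 1\<close>, \<open>-1\<close> breaks down only at
  \<open>m = -1\<close>, where \<open>q = m\<close>, and at \<open>m = -2\<close>, where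
  \<open>p = q\<close>.\<close>
proof (cases "m = -1 \<or> m = -2")
  case True
  then show ?thesis by (intro that[of "m + 3" "-3"]) auto
next
  case False
  then show ?thesis by (intro that[of "m + 1" "-1"]) auto
qed

lemma affine_eq_zero_imp:
  fixes c b t :: "'a::field_char_0"
  assumes "\<And>p::int. p \<noteq> 0 \<Longrightarrow> (c + b * of_int p) * t = 0" and "t \<noteq> 0"
  shows "c = 0" "b = 0"
proof -
  have "c + b = 0" "c - b = 0"
    using assms(1)[of 1] assms(1)[of "-1"] assms(2) by auto
  then have "2 * c = 0" by (simp add: algebra_simps)
  then show "c = 0" by simp
  with \<open>c + b = 0\<close> show "b = 0" by simp
qed

section \<open>The derivation identity in coordinates\<close>

locale w_post_lie = commutative_post_lie w_scale "w_bracket a b" pr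
  for a b :: complex and pr :: "w_space \<Rightarrow> w_space \<Rightarrow> w_space"
begin

lemma pr_add_right: "pr x (y + z) = pr x y + pr x z"
  using product_linear_right unfolding Vector_Spaces.linear_iff by blast

lemma pr_scale_right: "pr x (w_scale c y) = w_scale c (pr x y)"
  using product_linear_right unfolding Vector_Spaces.linear_iff by blast

lemma pr_zero_right: "pr x 0 = 0"
  using pr_add_right[of x 0 0] by simp

lemma pr_single_right: "pr x (Poly_Mapping.single i c) = w_scale c (pr x (Poly_Mapping.single i 1))"
  by (metis pr_scale_right w_scale_single mult.right_neutral)

lemma pr_eq_0_if_basis:
  assumes "\<And>i. i \<in> Poly_Mapping.keys y \<Longrightarrow> pr x (Poly_Mapping.single i 1) = 0"
  shows "pr x y = 0"
proof -
  let ?s = "\<lambda>i. Poly_Mapping.single i (Poly_Mapping.lookup y i)"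
  have y: "y = sum ?s (Poly_Mapping.keys y)"
    by (rule poly_mapping_eqI)
      (auto simp: lookup_sum lookup_single when_def in_keys_iff)
  have "pr x (sum ?s A) = 0" if "A \<subseteq> Poly_Mapping.keys y" for A
    using that
  proof (induction A rule: infinite_finite_induct)
    case (insert i A)
    then show ?case
      using assms[of i] pr_single_right[of x i "Poly_Mapping.lookup y i"]
      by (simp add: pr_add_right)
  qed (simp_all add: pr_zero_right)
  from this[OF order_refl] show ?thesis by (simp only: y[symmetric])
qed

text \<open>Antisymmetry puts both products into the left slot, where the coefficient formulas for
  bracketing with \<open>w_L n\<close> and \<open>w_I n\<close> apply.\<close>

lemma pr_bracket: "pr x (w_bracket a b y z) = w_bracket a b (pr x y) z - w_bracket a b (pr x z) y"
  by (metis product_bracket w_bracket_antisym diff_conv_add_uminus)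

lemma pr_bracket_LL:
  "w_scale (of_int (p - q)) (pr x (w_L (p + q)))
    = w_bracket a b (pr x (w_L p)) (w_L q) - w_bracket a b (pr x (w_L q)) (w_L p)"
  using pr_bracket[of x "w_L p" "w_L q"] by (simp add: pr_single_right[of _ _ "_ - _"])

lemma pr_bracket_LI:
  "w_scale (- (of_int q + a + b * of_int p)) (pr x (w_I (p + q)))
    = w_bracket a b (pr x (w_L p)) (w_I q) - w_bracket a b (pr x (w_I q)) (w_L p)"
  using pr_bracket[of x "w_L p" "w_I q"] pr_single_right[of x _ "- (of_int q + a + b * of_int p)"]
  by simp

lemma pr_bracket_II:
  "w_bracket a b (pr x (w_I p)) (w_I q) = w_bracket a b (pr x (w_I q)) (w_I p)"
  using pr_bracket[of x "w_I p" "w_I q"] by (simp add: pr_zero_right)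

lemma L_coeff_pr_LL:
  "of_int (p - q) * L_coeff (pr x (w_L (p + q))) k
    = of_int (k - 2 * q) * L_coeff (pr x (w_L p)) (k - q)
      - of_int (k - 2 * p) * L_coeff (pr x (w_L q)) (k - p)"
  using arg_cong[OF pr_bracket_LL, of "\<lambda>z. L_coeff z k"]
  by (simp add: lookup_minus coeff_bracket)

lemma I_coeff_pr_LL:
  "of_int (p - q) * I_coeff (pr x (w_L (p + q))) k
    = (of_int (k - q) + a + b * of_int q) * I_coeff (pr x (w_L p)) (k - q)
      - (of_int (k - p) + a + b * of_int p) * I_coeff (pr x (w_L q)) (k - p)"
  using arg_cong[OF pr_bracket_LL, of "\<lambda>z. I_coeff z k"]
  by (simp add: lookup_minus coeff_bracket)

lemma L_coeff_pr_LI: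
  "(of_int q + a + b * of_int p) * L_coeff (pr x (w_I (p + q))) k
    = of_int (k - 2 * p) * L_coeff (pr x (w_I q)) (k - p)"
proof -
  have "- (of_int q + a + b * of_int p) * L_coeff (pr x (w_I (p + q))) k
    = - (of_int (k - 2 * p) * L_coeff (pr x (w_I q)) (k - p))"
    using arg_cong[OF pr_bracket_LI, of "\<lambda>z. L_coeff z k"]
    unfolding lookup_w_scale lookup_minus coeff_bracket by (metis diff_0)
  then show ?thesis by (metis minus_mult_left neg_equal_iff_equal)
qed

lemma I_coeff_pr_LI:
  "(of_int q + a + b * of_int p) * I_coeff (pr x (w_I (p + q))) k
    = (of_int q + a + b * of_int (k - q)) * L_coeff (pr x (w_L p)) (k - q)
      + (of_int (k - p) + a + b * of_int p) * I_coeff (pr x (w_I q)) (k - p)"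
proof -
  have *: "s * u = t * v + w" if "- s * u = - t * v - w" for s t u v w :: complex
  proof -
    have "s * u = - (- s * u)" by simp
    also have "\<dots> = t * v + w" unfolding that by simp
    finally show ?thesis .
  qed
  show ?thesis
    using arg_cong[OF pr_bracket_LI, of "\<lambda>z. I_coeff z k"]
    unfolding lookup_w_scale lookup_minus coeff_bracket by (rule *)
qed

lemma L_coeff_pr_II:
  "(of_int q + a + b * of_int (k - q)) * L_coeff (pr x (w_I p)) (k - q)
    = (of_int p + a + b * of_int (k - p)) * L_coeff (pr x (w_I q)) (k - p)"
  using arg_cong[OF pr_bracket_II, of "\<lambda>z. - I_coeff z k"]
  unfolding coeff_bracket by (simp only: mult_minus_left minus_minus)

section \<open>Vanishing of the \<open>L\<close>-components of products of basis vectors\<close>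

text \<open>Bracketing with \<open>L 0\<close> is diagonal, so for \<open>k \<noteq> n\<close> the
  coefficient is determined by \<open>pr x (L 0)\<close>; the case \<open>k = n\<close> constrains
  \<open>pr x (L 0)\<close> itself.\<close>

lemma L_coeff_pr_L0:
  "of_int (k - n) * L_coeff (pr x (w_L n)) k
    = of_int (k - 2 * n) * L_coeff (pr x (w_L 0)) (k - n)"
  using L_coeff_pr_LL[of n 0 x k] by (simp add: algebra_simps)

lemma L_coeff_pr_L0_L_eq_0: "L_coeff (pr (w_L 0) (w_L n)) k = 0"
proof -
  let ?F = "\<lambda>n k. L_coeff (pr (w_L 0) (w_L n)) k"
  \<comment> \<open>For \<open>k = n = 1\<close> the left factor is 0 and the right one is
    -1.\<close>
  have zero: "?F m 0 = 0" for m
    using L_coeff_pr_L0[of 1 1 "w_L m"] by (simp add: product_commute[of "w_L m"])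
  have w: "?F 0 k = 0" for k
    using L_coeff_pr_L0[of 0 "-k" "w_L 0"] zero[of "-k"] zero[of 0] by (cases "k = 0") auto
  have diag: "?F n k = 0" if "k \<noteq> n" for n k
    using L_coeff_pr_L0[of k n "w_L 0"] w that by simp
  \<comment> \<open>By commutativity the coefficient \<open>?f\<close> can be reduced to a product
    with \<open>L 0\<close> in either argument; \<open>rel\<close> compares the two results.\<close>
  have rel: "of_int n * ?F m m = - of_int m * ?F n n" if "m \<noteq> n" for m n
  proof -
    let ?f = "L_coeff (pr (w_L m) (w_L n)) (m + n)"
    have m: "of_int m * ?f = of_int (m - n) * ?F m m"
      using L_coeff_pr_L0[of "m + n" n "w_L m"] by (simp add: product_commute)
    have n: "of_int n * ?f = of_int (n - m) * ?F n n"
      using L_coeff_pr_L0[of "m + n" m "w_L n"] by (simp add: product_commute)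
    have "of_int (m - n) * (of_int n * ?F m m) = of_int n * (of_int m * ?f)"
      unfolding m by (simp only: mult.left_commute)
    also have "\<dots> = of_int m * (of_int (n - m) * ?F n n)"
      unfolding n[symmetric] by (simp only: mult.left_commute)
    also have "\<dots> = of_int (m - n) * (- of_int m * ?F n n)"
      by (simp add: algebra_simps)
    finally show ?thesis using that by (metis mult_left_cancel of_int_eq_0_iff right_minus_eq)
  qed
  \<comment> \<open>The first two equations turn the third into
    \<open>-6 * ?F 1 1 = 6 * ?F 1 1\<close>.\<close>
  have "?F 2 2 = - 2 * ?F 1 1" "?F 3 3 = - 3 * ?F 1 1" "3 * ?F 2 2 = - 2 * ?F 3 3"
    using rel[of 2 1] rel[of 3 1] rel[of 2 3] by simp_all
  then have F1: "?F 1 1 = 0" by simp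
  have "?F n n = 0" for n
    using rel[of n 1] F1 by (cases "n = 1") simp_all
  with diag show ?thesis by metis
qed

text \<open>A nonzero coefficient at \<open>k\<close> would need \<open>k = n\<close> and, by
  commutativity, \<open>k = m\<close>. This leaves \<open>m = n\<close>, which is reached by
  splitting \<open>L m\<close> as a bracket.\<close>

lemma L_coeff_pr_L_L_eq_0: "L_coeff (pr (w_L m) (w_L n)) k = 0"
proof -
  have off: "L_coeff (pr (w_L m) (w_L n)) k = 0" if "k \<noteq> n" for m n k
    using L_coeff_pr_L0[of k n "w_L m"] that
    by (simp add: product_commute[of "w_L m" "w_L 0"] L_coeff_pr_L0_L_eq_0)
  have off': "L_coeff (pr (w_L m) (w_L n)) k = 0" if "m \<noteq> n" for m n k
    using off[of k n m] off[of k m n] that by (metis product_commute)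
  obtain p q where pq: "p + q = m" "p \<noteq> q" "p \<noteq> m" "q \<noteq> m" by (rule int_split_distinct)
  then have "L_coeff (pr (w_L m) (w_L m)) k = 0"
    using L_coeff_pr_LL[of p q "w_L m" k] off'[of m p] off'[of m q] by simp
  with off' show ?thesis by metis
qed

text \<open>\<open>D x\<close> commutes with \<open>ad (L 0)\<close> up to a bracket with
  \<open>pr x (L 0)\<close>, and that bracket has no \<open>L\<close>-component here; so
  \<open>L\<close>-components survive only at equal weight.\<close>

lemma L_coeff_pr_I_eq_0:
  assumes "of_int k \<noteq> of_int n + a"
  shows "L_coeff (pr x (w_I n)) k = 0"
  using L_coeff_pr_LI[of n 0 x k] assms by simp

lemma L_coeff_pr_L_I_eq_0: "L_coeff (pr (w_L m) (w_I n)) k = 0"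
proof (cases "of_int k = of_int n + a")
  case False
  then show ?thesis by (rule L_coeff_pr_I_eq_0)
next
  case k: True
  have off: "L_coeff (pr (w_L m) (w_I n)) j = 0" if "j \<noteq> k" for j m
    using that k by (intro L_coeff_pr_I_eq_0) (metis of_int_eq_iff)
  have shift: "of_int (j - m) * L_coeff (pr (w_L m) (w_I n)) j
    = of_int (j - 2 * m) * L_coeff (pr (w_L 0) (w_I n)) (j - m)" for j m
    using L_coeff_pr_L0[of j m "w_I n"] by (simp add: product_commute)
  \<comment> \<open>In \<open>shift\<close> at \<open>j = k + r\<close>, \<open>m = r\<close>, the
    condition \<open>r \<noteq> 0\<close> kills the left side and \<open>r \<noteq> k\<close> makes
    the right factor \<open>k - r\<close> nonzero.\<close>
  obtain r :: int where r: "r \<noteq> 0" "r \<noteq> k"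
    by (metis one_neq_zero zero_neq_numeral one_eq_numeral_iff num.distinct(1))
  have zero: "L_coeff (pr (w_L 0) (w_I n)) k = 0"
    using shift[of "k + r" r] off[of "k + r" r] r by simp
  have ne: "L_coeff (pr (w_L m) (w_I n)) k = 0" if "m \<noteq> k" for m
    using shift[of k m] zero off[of "k - m" 0] that by (cases "m = 0") auto
  obtain p q where "p + q = k" "p \<noteq> q" "p \<noteq> k" "q \<noteq> k" by (rule int_split_distinct)
  then have "L_coeff (pr (w_L k) (w_I n)) k = 0"
    using L_coeff_pr_LL[of p q "w_I n" k] ne off
    by (cases "p = 0"; cases "q = 0") (auto simp: product_commute[of "w_I n"])
  with ne show ?thesis by metis
qed

lemma L_coeff_pr_I_I_eq_0: "L_coeff (pr (w_I m) (w_I n)) k = 0"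
proof -
  have ne: "L_coeff (pr (w_I m) (w_I n)) k = 0" if "m \<noteq> n" for m n k
    \<comment> \<open>Commutativity would force both \<open>k = m + a\<close> and
      \<open>k = n + a\<close>.\<close>
    using L_coeff_pr_I_eq_0[of k m "w_I n"] L_coeff_pr_I_eq_0[of k n "w_I m"] that
    by (metis product_commute add_right_cancel of_int_eq_iff)
  have "L_coeff (pr (w_I n) (w_I n)) k = 0" for n k
  proof (rule ccontr)
    assume nz: "L_coeff (pr (w_I n) (w_I n)) k \<noteq> 0"
    \<comment> \<open>Bracketing with \<open>I q\<close> turns the \<open>L\<close>-component of
      \<open>pr (I n) (I n)\<close> into an \<open>I\<close>-component, while the opposite term
      contains \<open>pr (I n) (I q)\<close>, already known to have no
      \<open>L\<close>-component.\<close>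
    have "of_int q + a + b * of_int k = 0" if "q \<noteq> n" for q
      using L_coeff_pr_II[of q "k + q" "w_I n" n] ne[of n q] nz that by simp
    then have "of_int (n + 1) + a + b * of_int k = of_int (n + 2) + a + b * of_int k"
      by (metis add_cancel_left_right one_neq_zero zero_neq_numeral)
    then show False by simp
  qed
  with ne show ?thesis by metis
qed

section \<open>Vanishing of products with the ideal spanned by the \<open>I n\<close>\<close>

lemma I_coeff_pr_I_I_eq_0: "I_coeff (pr (w_I m) (w_I n)) k = 0"
proof -
  have LI: "(of_int q + a + b * of_int p) * I_coeff (pr (w_I n) (w_I (p + q))) k
    = (of_int (k - p) + a + b * of_int p) * I_coeff (pr (w_I n) (w_I q)) (k - p)" for n p q k
    using I_coeff_pr_LI[of q p "w_I n" k]
    by (simp add: product_commute[of "w_I n"] L_coeff_pr_L_I_eq_0)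
  have off: "I_coeff (pr (w_I m) (w_I n)) k = 0" if "k \<noteq> n" for m n k
    using LI[of n 0 m k] that by simp
  have ne: "I_coeff (pr (w_I m) (w_I n)) k = 0" if "m \<noteq> n" for m n k
    using off[of k n m] off[of k m n] that by (metis product_commute)
  have "I_coeff (pr (w_I n) (w_I n)) n = 0" for n
  proof (rule ccontr)
    assume nz: "I_coeff (pr (w_I n) (w_I n)) n \<noteq> 0"
    \<comment> \<open>Moving from \<open>I n\<close> to \<open>I (p + n)\<close> leaves the
      diagonal, where the coefficient is known to vanish.\<close>
    have "(of_int n + a + b * of_int p) * I_coeff (pr (w_I n) (w_I n)) n = 0" if "p \<noteq> 0" for p
      using LI[of n p n "p + n"] ne[of n "p + n"] that by simp
    note affine_eq_zero_imp[OF this nz]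
    \<comment> \<open>Now \<open>n + a = 0\<close> and \<open>b = 0\<close>, so the step from
      \<open>I (n - 1)\<close> up to \<open>I n\<close> carries the nonzero factor -1 and kills the
      diagonal coefficient.\<close>
    then show False
      using LI[of "n - 1" 1 n n] ne[of n "n - 1"] nz by (simp add: algebra_simps)
  qed
  with ne off show ?thesis by metis
qed

text \<open>Weights leave only \<open>k = n\<close>. Expanding \<open>[L p, L 0]\<close> in the
  other argument then excludes every \<open>p\<close> except \<open>p = n + a\<close>, and that
  index is split as a sum.\<close>

lemma I_coeff_pr_L_I_eq_0: "I_coeff (pr (w_L m) (w_I n)) k = 0"
proof -
  have off: "I_coeff (pr (w_L m) (w_I n)) k = 0" if "k \<noteq> n" for m k
    using I_coeff_pr_LI[of n 0 "w_L m" k] that by (simp add: L_coeff_pr_L_L_eq_0)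
  have LL: "of_int (p - q) * I_coeff (pr (w_L (p + q)) (w_I n)) k
    = (of_int (k - q) + a + b * of_int q) * I_coeff (pr (w_L p) (w_I n)) (k - q)
      - (of_int (k - p) + a + b * of_int p) * I_coeff (pr (w_L q) (w_I n)) (k - p)" for p q k
    using I_coeff_pr_LL[of p q "w_I n" k] by (simp add: product_commute[of "w_I n"])
  have zero: "of_int n + a = 0" if nz: "I_coeff (pr (w_L 0) (w_I n)) n \<noteq> 0"
  proof -
    \<comment> \<open>At \<open>k = n + p\<close> with \<open>p \<noteq> 0\<close> both terms
      containing \<open>L p\<close> are off-diagonal and vanish.\<close>
    have "(of_int n + a + b * of_int p) * I_coeff (pr (w_L 0) (w_I n)) n = 0" if "p \<noteq> 0" for p
      using LL[of p 0 "n + p"] off[of "n + p" p] that by simp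
    from affine_eq_zero_imp(1)[OF this nz] show ?thesis .
  qed
  have ne: "I_coeff (pr (w_L p) (w_I n)) n = 0" if "of_int p \<noteq> of_int n + a" for p
    using LL[of p 0 n] off[of "n - p" 0] zero that by (cases "p = 0") auto
  have "I_coeff (pr (w_L p) (w_I n)) n = 0" for p
  proof (cases "of_int p = of_int n + a")
    case True
    obtain r s where "r + s = p" "r \<noteq> s" "r \<noteq> p" "s \<noteq> p" by (rule int_split_distinct)
    moreover have "I_coeff (pr (w_L j) (w_I n)) i = 0" if "j \<noteq> p" for i j
      using ne[of j] off[of i j] that True by (metis of_int_eq_iff)
    ultimately show ?thesis using LL[of r s n] by simp
  qed (rule ne)
  with off show ?thesis by metis
qed

section \<open>From basis vectors to arbitrary elements\<close>

lemma pr_I_right_eq_0: "pr x (w_I n) = 0"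
proof -
  have "pr (w_I n) (Poly_Mapping.single i 1) = 0" for i
    by (cases i; rule w_space_eqI)
      (simp_all add: product_commute[of "w_I n"] L_coeff_pr_L_I_eq_0 I_coeff_pr_L_I_eq_0
        L_coeff_pr_I_I_eq_0 I_coeff_pr_I_I_eq_0)
  then show ?thesis
    by (metis product_commute pr_eq_0_if_basis)
qed

lemma pr_eq_0_if_L_coeff_eq_0:
  assumes "\<And>k. L_coeff y k = 0"
  shows "pr x y = 0"
proof (rule pr_eq_0_if_basis)
  show "pr x (Poly_Mapping.single i 1) = 0" if "i \<in> Poly_Mapping.keys y" for i
    using that assms by (cases i) (auto simp: in_keys_iff pr_I_right_eq_0)
qed

lemma pr_L_L_eq_0: "pr (w_L m) (w_L n) = 0"
proof -
  obtain p q where pq: "p + q = m" "p \<noteq> q" by (rule int_split_distinct)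
  have "pr (w_bracket a b (w_L p) (w_L q)) (w_L n) = 0"
    \<comment> \<open>The inner products have no \<open>L\<close>-components, so the outer products
      vanish.\<close>
    by (simp only: bracket_product pr_eq_0_if_L_coeff_eq_0 L_coeff_pr_L_L_eq_0 diff_0_right)
  then have "w_scale (of_int (p - q)) (pr (w_L n) (w_L m)) = 0"
    using pq by (simp add: product_commute[of _ "w_L n"] pr_single_right[of _ _ "_ - _"])
  with pq show ?thesis
    by (metis product_commute w.scale_eq_0_iff of_int_eq_0_iff right_minus_eq)
qed

lemma pr_eq_0: "pr x y = 0"
proof (rule pr_eq_0_if_basis)
  have L: "pr x (w_L n) = 0" for n
  proof -
    have "pr (w_L n) (Poly_Mapping.single i 1) = 0" for i
      by (cases i) (simp_all add: pr_L_L_eq_0 pr_I_right_eq_0)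
    then show ?thesis by (metis product_commute pr_eq_0_if_basis)
  qed
  show "pr x (Poly_Mapping.single i 1) = 0" for i
    by (cases i) (simp_all add: L pr_I_right_eq_0)
qed

end

theorem theorem4p3:
  fixes a b :: complex and pr :: "w_space \<Rightarrow> w_space \<Rightarrow> w_space"
  assumes "commutative_post_lie w_scale (w_bracket a b) pr"
  shows "\<forall>x y. pr x y = 0"
proof -
  from assms interpret w_post_lie a b pr by (rule w_post_lie.intro)
  show ?thesis using pr_eq_0 by blast
qed

end
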